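(* Take $N=2$. For $\sigma,\tau\in\{X,Y,Z\}$ let $C(\sigma,\tau)_{01}=\tfrac12(I+\sigma_0)+\tfrac12(I-\sigma_0)\tau_1$ (so $C(Z,X)_{01}=\mathrm{CX}_{01}$ and $C(Z,Z)_{01}=\mathrm{CZ}_{01}$). Then: (i) the nine frames $C(\sigma,\tau)_{01}\cdot B_0$ (backward action) lie in nine pairwise distinct EEF classes, none of which equals $[B_0]$; and (ii) for all unitaries $L_1,L_2$ in the group generated by single-qubit Clifford gates and $\mathrm{SWAP}_{01}$, the frame $(L_2\,\mathrm{CX}_{01}\,L_1)\cdot B_0$ lies in one of these nine EEF classes. Consequently, in $[\mathrm{PFG}_N]$ each vertex has, for each pair of qubits, exactly nine neighbours reachable by a single two-qubit entangling gate on that pair.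
   Context: Pauli space: $\mathcal P$ is the set of $N$-qubit Pauli operators modulo overall phase, an $\mathbb F_2$-vector space with addition given by product (mod phase); $\lambda(p,q)\in\mathbb F_2$ is $0$ if $p,q$ commute and $1$ otherwise. A Pauli frame is an ordered tuple $B=\{(s_i,\tilde s_i)\}_{0\le i<N}$ of elements of $\mathcal P$ with $\lambda(s_i,s_j)=\lambda(\tilde s_i,\tilde s_j)=0$, $\lambda(s_i,\tilde s_j)=\delta_{ij}$. The origin frame is $B_0=\{(Z_i,X_i)\}_i$. For a frame $B$ let $\phi_B$ be the linear map of $\mathcal P$ with $\phi_B(Z_i)=s_i$, $\phi_B(X_i)=\tilde s_i$. The backward action of a Clifford unitary $V$ on a frame $B$ is $V\cdot B:=\{(\phi_B(V^\dagger Z_iV),\phi_B(V^\dagger X_iV))\}_i$ (mod phase); in particular $V\cdot B_0=\{(V^\dagger Z_iV,V^\dagger X_iV)\}_i$. $\bar E_N$ is the group of actions on frames generated by the backward actions of $\mathrm{SWAP}_{ij}$, Hadamard $H_i$ and phase gate $P_i=R_Z(\pi/2)$. The EEF class of $B$ is $[B]=\{\gamma\cdot B:\gamma\in\bar E_N\}$. $[\mathrm{PFG}_N]$ is the graph on EEF classes with $[B_1],[B_2]$ adjacent iff $B_2'=\mathrm{CX}_{ij}\cdot B_1'$ for some $B_1'\in[B_1]$, $B_2'\in[B_2]$, $i\neq j$. *)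

theory Defs
  imports "HOL-Analysis.Analysis"
begin

text \<open>Computational basis of one qubit is indexed by bool (False = |0>, True = |1>).
  Two-qubit basis states are indexed by bool x bool, the first component being
  the bit of qubit 0, the second that of qubit 1.\<close>

type_synonym mat2 = "complex^bool^bool"
type_synonym mat4 = "complex^(bool\<times>bool)^(bool\<times>bool)"

definition adj :: "complex^'n^'n \<Rightarrow> complex^'n^'n" where
  "adj M = (\<chi> i j. cnj (M $ j $ i))"

definition smul :: "complex \<Rightarrow> complex^'n^'n \<Rightarrow> complex^'n^'n" where
  "smul c M = (\<chi> i j. c * M $ i $ j)"

definition madd :: "complex^'n^'n \<Rightarrow> complex^'n^'n \<Rightarrow> complex^'n^'n" where
  "madd A B = (\<chi> i j. A $ i $ j + B $ i $ j)"

definition kron :: "mat2 \<Rightarrow> mat2 \<Rightarrow> mat4" where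
  "kron A B = (\<chi> r c. A $ fst r $ fst c * B $ snd r $ snd c)"

definition unitary :: "complex^'n^'n \<Rightarrow> bool" where
  "unitary U \<longleftrightarrow> adj U ** U = mat 1 \<and> U ** adj U = mat 1"

definition pX :: mat2 where "pX = (\<chi> i j. if i \<noteq> j then 1 else 0)"
definition pZ :: mat2 where "pZ = (\<chi> i j. if i = j then (if i then -1 else 1) else 0)"
definition pY :: mat2 where
  "pY = (\<chi> i j. if i = j then 0 else (if i then \<i> else - \<i>))"

text \<open>Hadamard and phase gate P = R_Z(pi/2) = exp(-i (pi/2) Z / 2).\<close>
definition hadamard :: mat2 where
  "hadamard = (\<chi> i j. complex_of_real (1 / sqrt 2) * (if i \<and> j then -1 else 1))"
definition phaseP :: mat2 where
  "phaseP = (\<chi> i j. if i = j then (if i then cis (pi/4) else cis (- pi/4)) else 0)"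

definition SWAP :: mat4 where
  "SWAP = (\<chi> r c. if r = (snd c, fst c) then 1 else 0)"

text \<open>CX_{01}: control qubit 0, target qubit 1.\<close>
definition CX01 :: mat4 where
  "CX01 = (\<chi> r c. if r = (fst c, if fst c then \<not> snd c else snd c) then 1 else 0)"

definition ctrl :: "mat2 \<Rightarrow> mat2 \<Rightarrow> mat4" where
  "ctrl \<sigma> \<tau> =
     madd (smul (1/2) (madd (mat 1) (kron \<sigma> (mat 1))))
          (smul (1/2) (madd (mat 1) (smul (-1) (kron \<sigma> (mat 1))) ** kron (mat 1) \<tau>))"

text \<open>An element of the Pauli space is represented by its Z-bits and X-bits
  ((z0,z1),(x0,x1)); it stands for the Pauli operator (mod phase)
  (Z^z0 X^x0) tensor (Z^z1 X^x1).  Addition (product mod phase) is bitwise xor.\<close>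

type_synonym pauli = "(bool\<times>bool)\<times>(bool\<times>bool)"

definition pm1 :: "bool \<Rightarrow> bool \<Rightarrow> mat2" where
  "pm1 z x = (if z then pZ else mat 1) ** (if x then pX else mat 1)"

definition pmat :: "pauli \<Rightarrow> mat4" where
  "pmat p = kron (pm1 (fst (fst p)) (fst (snd p))) (pm1 (snd (fst p)) (snd (snd p)))"

definition pzero :: pauli where "pzero = ((False,False),(False,False))"

definition padd :: "pauli \<Rightarrow> pauli \<Rightarrow> pauli" where
  "padd p q = ((fst (fst p) \<noteq> fst (fst q), snd (fst p) \<noteq> snd (fst q)),
               (fst (snd p) \<noteq> fst (snd q), snd (snd p) \<noteq> snd (snd q)))"

definition bit2 :: "nat \<Rightarrow> bool\<times>bool" where
  "bit2 i = (if i = 0 then (True,False) else (False,True))"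

definition Zq :: "nat \<Rightarrow> pauli" where "Zq i = (bit2 i, (False,False))"
definition Xq :: "nat \<Rightarrow> pauli" where "Xq i = ((False,False), bit2 i)"

definition lam :: "pauli \<Rightarrow> pauli \<Rightarrow> bool" where
  "lam p q \<longleftrightarrow> pmat p ** pmat q \<noteq> pmat q ** pmat p"

definition modphase :: "mat4 \<Rightarrow> pauli" where
  "modphase M = (THE q. \<exists>c. M = smul c (pmat q))"

text \<open>A frame is the ordered tuple ((s_0, s~_0), (s_1, s~_1)).\<close>
type_synonym frame = "(pauli\<times>pauli)\<times>(pauli\<times>pauli)"

definition fr :: "frame \<Rightarrow> nat \<Rightarrow> pauli\<times>pauli" where
  "fr B i = (if i = 0 then fst B else snd B)"

definition is_frame :: "frame \<Rightarrow> bool" where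
  "is_frame B \<longleftrightarrow> (\<forall>i<2. \<forall>j<2.
      \<not> lam (fst (fr B i)) (fst (fr B j)) \<and> \<not> lam (snd (fr B i)) (snd (fr B j)) \<and>
      lam (fst (fr B i)) (snd (fr B j)) = (i = j))"

definition B0 :: frame where "B0 = ((Zq 0, Xq 0), (Zq 1, Xq 1))"

definition phi :: "frame \<Rightarrow> pauli \<Rightarrow> pauli" where
  "phi B p = padd (padd (if fst (fst p) then fst (fr B 0) else pzero)
                        (if snd (fst p) then fst (fr B 1) else pzero))
                  (padd (if fst (snd p) then snd (fr B 0) else pzero)
                        (if snd (snd p) then snd (fr B 1) else pzero))"

definition bact :: "mat4 \<Rightarrow> frame \<Rightarrow> frame" where
  "bact V B =
     ((phi B (modphase (adj V ** pmat (Zq 0) ** V)), phi B (modphase (adj V ** pmat (Xq 0) ** V))),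
      (phi B (modphase (adj V ** pmat (Zq 1) ** V)), phi B (modphase (adj V ** pmat (Xq 1) ** V))))"

definition egens :: "mat4 set" where
  "egens = {SWAP, kron hadamard (mat 1), kron (mat 1) hadamard,
            kron phaseP (mat 1), kron (mat 1) phaseP}"

inductive_set Ebar :: "(frame \<Rightarrow> frame) set" where
  Ebar_id: "id \<in> Ebar"
| Ebar_gen: "\<gamma> \<in> Ebar \<Longrightarrow> g \<in> egens \<Longrightarrow> bact g \<circ> \<gamma> \<in> Ebar"
| Ebar_inv: "\<gamma> \<in> Ebar \<Longrightarrow> g \<in> egens \<Longrightarrow> inv (bact g) \<circ> \<gamma> \<in> Ebar"

definition eef_class :: "frame \<Rightarrow> frame set" where
  "eef_class B = {\<gamma> B | \<gamma>. \<gamma> \<in> Ebar}"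

definition clifford1 :: "mat2 \<Rightarrow> bool" where
  "clifford1 U \<longleftrightarrow> unitary U \<and>
     (\<forall>z x. \<exists>z' x' c. U ** pm1 z x ** adj U = smul c (pm1 z' x'))"

inductive_set LocCliff :: "mat4 set" where
  LC_one: "mat 1 \<in> LocCliff"
| LC_swap: "SWAP \<in> LocCliff"
| LC_q0: "clifford1 U \<Longrightarrow> kron U (mat 1) \<in> LocCliff"
| LC_q1: "clifford1 U \<Longrightarrow> kron (mat 1) U \<in> LocCliff"
| LC_mult: "A \<in> LocCliff \<Longrightarrow> B \<in> LocCliff \<Longrightarrow> A ** B \<in> LocCliff"
| LC_adj: "A \<in> LocCliff \<Longrightarrow> adj A \<in> LocCliff"

definition paulis3 :: "mat2 set" where "paulis3 = {pX, pY, pZ}"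

end

theory Submission
  imports Defs
begin

text \<open>
  Everything is read off the conjugation maps of Cliffords, which are linear and preserve
  the commutation form \<open>\<lambda>\<close>. A Clifford with conjugation map \<open>h\<close> acts on a frame \<open>B\<close> by
  \<open>\<phi>\<^sub>B \<mapsto> \<phi>\<^sub>B \<circ> h\<close>; SWAP, \<open>H\<close> and \<open>P\<close> give five involutions generating the local symplectic
  maps, so an EEF class is an orbit of that group. Writing a frame as pairs \<open>(s\<^sub>i, t\<^sub>i)\<close>, the
  unordered pair of planes \<open>{s\<^sub>i, t\<^sub>i, s\<^sub>i t\<^sub>i}\<close> is invariant under the generators, and it
  separates the nine frames \<open>C(\<sigma>,\<tau>) \<cdot> B\<^sub>0\<close> from each other and from \<open>B\<^sub>0\<close>.

  Conjugation by \<open>C(\<sigma>,\<tau>)\<close> is \<open>p \<mapsto> p + \<lambda>(p,\<sigma>\<^sub>0) \<tau>\<^sub>1 + \<lambda>(p,\<tau>\<^sub>1) \<sigma>\<^sub>0\<close>. A symplectic map \<open>h\<close>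
  conjugates this into the same formula with \<open>h \<sigma>\<^sub>0, h \<tau>\<^sub>1\<close>, and a local map keeps these
  single-qubit Paulis on distinct qubits; hence \<open>L\<^sub>2 CX L\<^sub>1 \<cdot> B\<^sub>0\<close> lies in the class of some
  \<open>C(\<sigma>',\<tau>') \<cdot> B\<^sub>0\<close>.
\<close>

lemma all_bool_pair:
  "(\<forall>x::bool\<times>bool. P x) \<longleftrightarrow> P (False,False) \<and> P (False,True) \<and> P (True,False) \<and> P (True,True)"
  by (metis (full_types) surj_pair)

lemma sum_bool_pair:
  "sum f (UNIV::(bool\<times>bool) set) = f (False,False) + f (False,True) + f (True,False) + f (True,True)"
proof -
  have UNIV_pairs: "(UNIV::(bool\<times>bool) set) = {(False,False),(False,True),(True,False),(True,True)}"
    by auto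
  show ?thesis by (simp add: UNIV_pairs add.assoc)
qed

definition mat2_of :: "complex \<Rightarrow> complex \<Rightarrow> complex \<Rightarrow> complex \<Rightarrow> mat2" where
  "mat2_of a00 a01 a10 a11 = (\<chi> r c. if r then (if c then a11 else a10) else (if c then a01 else a00))"

definition mat4_of ::
  "complex \<Rightarrow> complex \<Rightarrow> complex \<Rightarrow> complex \<Rightarrow> complex \<Rightarrow> complex \<Rightarrow> complex \<Rightarrow> complex \<Rightarrow>
   complex \<Rightarrow> complex \<Rightarrow> complex \<Rightarrow> complex \<Rightarrow> complex \<Rightarrow> complex \<Rightarrow> complex \<Rightarrow> complex \<Rightarrow> mat4" where
  "mat4_of a00 a01 a02 a03 a10 a11 a12 a13 a20 a21 a22 a23 a30 a31 a32 a33 =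
     (\<chi> r c. let row = (\<lambda>b0 b1 b2 b3. if c = (False,False) then b0 else if c = (False,True) then b1
                                          else if c = (True,False) then b2 else b3)
            in if r = (False,False) then row a00 a01 a02 a03 else if r = (False,True) then row a10 a11 a12 a13
               else if r = (True,False) then row a20 a21 a22 a23 else row a30 a31 a32 a33)"

lemma mat2_eq_iff:
  "(A::mat2) = B \<longleftrightarrow> A$False$False = B$False$False \<and> A$False$True = B$False$True
     \<and> A$True$False = B$True$False \<and> A$True$True = B$True$True"
  by (auto simp: vec_eq_iff) (metis (full_types))

lemma mat4_eq_iff: "(A::mat4) = B \<longleftrightarrow> (\<forall>i j. A$i$j = B$i$j)"
  by (auto simp: vec_eq_iff)

lemma mat2_of_eq_iff:
  "mat2_of a00 a01 a10 a11 = mat2_of b00 b01 b10 b11 \<longleftrightarrow> a00 = b00 \<and> a01 = b01 \<and> a10 = b10 \<and> a11 = b11"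
  by (simp add: mat2_eq_iff mat2_of_def)

lemma mat4_of_eq_iff:
  "mat4_of a00 a01 a02 a03 a10 a11 a12 a13 a20 a21 a22 a23 a30 a31 a32 a33
     = mat4_of b00 b01 b02 b03 b10 b11 b12 b13 b20 b21 b22 b23 b30 b31 b32 b33 \<longleftrightarrow>
   a00 = b00 \<and> a01 = b01 \<and> a02 = b02 \<and> a03 = b03 \<and> a10 = b10 \<and> a11 = b11 \<and> a12 = b12 \<and> a13 = b13 \<and>
   a20 = b20 \<and> a21 = b21 \<and> a22 = b22 \<and> a23 = b23 \<and> a30 = b30 \<and> a31 = b31 \<and> a32 = b32 \<and> a33 = b33"
  unfolding mat4_eq_iff all_bool_pair by (auto simp: mat4_of_def Let_def)

lemma mat2_of_mult:
  "mat2_of a00 a01 a10 a11 ** mat2_of b00 b01 b10 b11 =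
   mat2_of (a00*b00+a01*b10) (a00*b01+a01*b11) (a10*b00+a11*b10) (a10*b01+a11*b11)"
  by (simp add: mat2_eq_iff mat2_of_def matrix_matrix_mult_def UNIV_bool)

lemma mat4_of_mult:
  "mat4_of a00 a01 a02 a03 a10 a11 a12 a13 a20 a21 a22 a23 a30 a31 a32 a33
   ** mat4_of b00 b01 b02 b03 b10 b11 b12 b13 b20 b21 b22 b23 b30 b31 b32 b33 =
   mat4_of (a00*b00 + a01*b10 + a02*b20 + a03*b30) (a00*b01 + a01*b11 + a02*b21 + a03*b31)
           (a00*b02 + a01*b12 + a02*b22 + a03*b32) (a00*b03 + a01*b13 + a02*b23 + a03*b33)
           (a10*b00 + a11*b10 + a12*b20 + a13*b30) (a10*b01 + a11*b11 + a12*b21 + a13*b31)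
           (a10*b02 + a11*b12 + a12*b22 + a13*b32) (a10*b03 + a11*b13 + a12*b23 + a13*b33)
           (a20*b00 + a21*b10 + a22*b20 + a23*b30) (a20*b01 + a21*b11 + a22*b21 + a23*b31)
           (a20*b02 + a21*b12 + a22*b22 + a23*b32) (a20*b03 + a21*b13 + a22*b23 + a23*b33)
           (a30*b00 + a31*b10 + a32*b20 + a33*b30) (a30*b01 + a31*b11 + a32*b21 + a33*b31)
           (a30*b02 + a31*b12 + a32*b22 + a33*b32) (a30*b03 + a31*b13 + a32*b23 + a33*b33)"
  unfolding mat4_eq_iff all_bool_pair by (simp add: mat4_of_def matrix_matrix_mult_def sum_bool_pair)

lemma mat2_of_adj: "adj (mat2_of a00 a01 a10 a11) = mat2_of (cnj a00) (cnj a10) (cnj a01) (cnj a11)"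
  by (simp add: mat2_eq_iff mat2_of_def adj_def)

lemma mat4_of_adj:
  "adj (mat4_of a00 a01 a02 a03 a10 a11 a12 a13 a20 a21 a22 a23 a30 a31 a32 a33) =
   mat4_of (cnj a00) (cnj a10) (cnj a20) (cnj a30) (cnj a01) (cnj a11) (cnj a21) (cnj a31)
           (cnj a02) (cnj a12) (cnj a22) (cnj a32) (cnj a03) (cnj a13) (cnj a23) (cnj a33)"
  unfolding mat4_eq_iff all_bool_pair by (simp add: mat4_of_def adj_def)

lemma mat2_of_smul: "smul k (mat2_of a00 a01 a10 a11) = mat2_of (k*a00) (k*a01) (k*a10) (k*a11)"
  by (simp add: mat2_eq_iff mat2_of_def smul_def)

lemma mat4_of_smul:
  "smul k (mat4_of a00 a01 a02 a03 a10 a11 a12 a13 a20 a21 a22 a23 a30 a31 a32 a33) =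
   mat4_of (k*a00) (k*a01) (k*a02) (k*a03) (k*a10) (k*a11) (k*a12) (k*a13)
           (k*a20) (k*a21) (k*a22) (k*a23) (k*a30) (k*a31) (k*a32) (k*a33)"
  unfolding mat4_eq_iff all_bool_pair by (simp add: mat4_of_def smul_def)

lemma mat4_of_madd:
  "madd (mat4_of a00 a01 a02 a03 a10 a11 a12 a13 a20 a21 a22 a23 a30 a31 a32 a33)
        (mat4_of b00 b01 b02 b03 b10 b11 b12 b13 b20 b21 b22 b23 b30 b31 b32 b33) =
   mat4_of (a00+b00) (a01+b01) (a02+b02) (a03+b03) (a10+b10) (a11+b11) (a12+b12) (a13+b13)
           (a20+b20) (a21+b21) (a22+b22) (a23+b23) (a30+b30) (a31+b31) (a32+b32) (a33+b33)"
  unfolding mat4_eq_iff all_bool_pair by (simp add: mat4_of_def madd_def)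

lemma mat2_of_kron:
  "kron (mat2_of a00 a01 a10 a11) (mat2_of b00 b01 b10 b11) =
   mat4_of (a00*b00) (a00*b01) (a01*b00) (a01*b01) (a00*b10) (a00*b11) (a01*b10) (a01*b11)
           (a10*b00) (a10*b01) (a11*b00) (a11*b01) (a10*b10) (a10*b11) (a11*b10) (a11*b11)"
  unfolding mat4_eq_iff all_bool_pair by (simp add: mat4_of_def mat2_of_def kron_def)

lemma mat4_of_entries:
  "(A::mat4) = mat4_of
     (A$(False,False)$(False,False)) (A$(False,False)$(False,True)) (A$(False,False)$(True,False)) (A$(False,False)$(True,True))
     (A$(False,True)$(False,False)) (A$(False,True)$(False,True)) (A$(False,True)$(True,False)) (A$(False,True)$(True,True))
     (A$(True,False)$(False,False)) (A$(True,False)$(False,True)) (A$(True,False)$(True,False)) (A$(True,False)$(True,True))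
     (A$(True,True)$(False,False)) (A$(True,True)$(False,True)) (A$(True,True)$(True,False)) (A$(True,True)$(True,True))"
  unfolding mat4_eq_iff all_bool_pair by (simp add: mat4_of_def)

lemma pX_mat: "pX = mat2_of 0 1 1 0"
  and pY_mat: "pY = mat2_of 0 (-\<i>) \<i> 0"
  and pZ_mat: "pZ = mat2_of 1 0 0 (-1)"
  and id2_mat: "(mat 1::mat2) = mat2_of 1 0 0 1"
  by (simp_all add: mat2_eq_iff mat2_of_def pX_def pY_def pZ_def mat_def)

lemma id4_mat: "(mat 1::mat4) = mat4_of 1 0 0 0 0 1 0 0 0 0 1 0 0 0 0 1"
  unfolding mat4_eq_iff all_bool_pair by (simp add: mat4_of_def mat_def)

lemma pm1_mat: "pm1 z x = mat2_of (if x then 0 else 1) (if x then 1 else 0)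
   (if x then (if z then -1 else 1) else 0) (if x then 0 else (if z then -1 else 1))"
  by (cases z; cases x) (simp_all add: pm1_def pZ_mat pX_mat id2_mat mat2_of_mult)

lemmas mat_literal_simps = pX_mat pY_mat pZ_mat id2_mat id4_mat pm1_mat pmat_def
  mat2_of_kron mat4_of_madd mat4_of_smul mat4_of_mult mat4_of_adj mat4_of_eq_iff

lemma adj_mult: "adj (A ** B) = adj B ** (adj A :: complex^'n^'n)"
  by (simp add: vec_eq_iff adj_def matrix_matrix_mult_def mult.commute)

lemma adj_adj [simp]: "adj (adj A) = A"
  by (simp add: vec_eq_iff adj_def)

lemma adj_one [simp]: "adj (mat 1) = (mat 1 :: complex^'n^'n)"
  by (simp add: vec_eq_iff adj_def mat_def)

lemma smul_mult_left: "smul c A ** B = smul c (A ** (B::complex^'n^'n))"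
  by (simp add: vec_eq_iff smul_def matrix_matrix_mult_def sum_distrib_left mult.assoc)

lemma smul_mult_right: "A ** smul c B = smul c (A ** (B::complex^'n^'n))"
  by (simp add: vec_eq_iff smul_def matrix_matrix_mult_def sum_distrib_left algebra_simps)

lemma smul_smul [simp]: "smul a (smul b A) = smul (a * b) A"
  by (simp add: vec_eq_iff smul_def)

lemma smul_one [simp]: "smul 1 A = A"
  by (simp add: vec_eq_iff smul_def)

lemma smul_cancel: "k \<noteq> 0 \<Longrightarrow> smul k A = smul k B \<longleftrightarrow> A = B"
  by (auto simp: vec_eq_iff smul_def)

lemma kron_mult: "kron A B ** kron C D = kron (A ** C) (B ** D)"
  unfolding mat4_eq_iff all_bool_pair
  by (simp add: kron_def matrix_matrix_mult_def sum_bool_pair UNIV_bool algebra_simps)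

lemma adj_kron: "adj (kron A B) = kron (adj A) (adj B)"
  unfolding mat4_eq_iff all_bool_pair by (simp add: kron_def adj_def)

lemma kron_smul_left: "kron (smul c A) B = smul c (kron A B)"
  unfolding mat4_eq_iff all_bool_pair by (simp add: kron_def smul_def)

lemma kron_smul_right: "kron A (smul c B) = smul c (kron A B)"
  unfolding mat4_eq_iff all_bool_pair by (simp add: kron_def smul_def)

lemma kron_one: "kron (mat 1) (mat 1) = mat 1"
  unfolding mat4_eq_iff all_bool_pair by (simp add: kron_def mat_def)

lemma SWAP_conj_kron: "SWAP ** kron A B ** SWAP = kron B A"
  unfolding mat4_eq_iff all_bool_pair by (simp add: kron_def SWAP_def matrix_matrix_mult_def sum_bool_pair)

lemma adj_SWAP: "adj SWAP = SWAP"
  unfolding mat4_eq_iff all_bool_pair by (simp add: adj_def SWAP_def)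

lemma unitary_SWAP: "unitary SWAP"
  unfolding unitary_def adj_SWAP mat4_eq_iff all_bool_pair
  by (simp add: mat_def SWAP_def matrix_matrix_mult_def sum_bool_pair)

lemma unitary_one: "unitary (mat 1)"
  by (simp add: unitary_def)

lemma unitary_adj: "unitary A \<Longrightarrow> unitary (adj A)"
  unfolding unitary_def by simp

lemma unitary_mult:
  assumes "unitary A" "unitary B"
  shows "unitary (A ** B)"
proof -
  have "adj (A ** B) ** (A ** B) = adj B ** ((adj A ** A) ** B)"
    and "(A ** B) ** adj (A ** B) = A ** ((B ** adj B) ** adj A)"
    by (simp_all add: adj_mult matrix_mul_assoc)
  with assms show ?thesis unfolding unitary_def by simp
qed

lemma unitary_kron: "unitary U \<Longrightarrow> unitary V \<Longrightarrow> unitary (kron U V)"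
  unfolding unitary_def by (simp add: adj_kron kron_mult kron_one)

lemma unitary_conj_cancel:
  assumes "unitary U"
  shows "U ** (adj U ** M ** U) ** adj U = M" and "adj U ** (U ** M ** adj U) ** U = M"
proof -
  have "U ** (adj U ** M ** U) ** adj U = (U ** adj U) ** M ** (U ** adj U)"
    and "adj U ** (U ** M ** adj U) ** U = (adj U ** U) ** M ** (adj U ** U)"
    by (simp_all add: matrix_mul_assoc)
  with assms show "U ** (adj U ** M ** U) ** adj U = M" and "adj U ** (U ** M ** adj U) ** U = M"
    unfolding unitary_def by simp_all
qed

lemma unitary_conj_mult:
  assumes "unitary V"
  shows "adj V ** (P ** Q) ** V = (adj V ** P ** V) ** (adj V ** Q ** V)"
proof -
  have "(adj V ** P ** V) ** (adj V ** Q ** V) = adj V ** P ** ((V ** adj V) ** Q) ** V"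
    by (simp add: matrix_mul_assoc)
  with assms show ?thesis unfolding unitary_def by (simp add: matrix_mul_assoc)
qed

section \<open>Pauli operators\<close>

lemma pm1_mult: "pm1 a b ** pm1 c d = smul (if b \<and> c then -1 else 1) (pm1 (a \<noteq> c) (b \<noteq> d))"
  by (cases a; cases b; cases c; cases d) (simp_all add: pm1_mat mat2_of_mult mat2_of_smul)

lemma pm1_neq_smul_zero: "pm1 a b \<noteq> smul 0 A"
  by (cases a; cases b) (simp_all add: pm1_mat mat2_eq_iff mat2_of_def smul_def)

text \<open>The sign in \<open>P\<^sub>p P\<^sub>q = sign p q P\<^sub>p\<^sub>q\<close> comes from commuting
  the X-part of \<open>p\<close> past the Z-part of \<open>q\<close>.\<close>

definition pauli_sign :: "pauli \<Rightarrow> pauli \<Rightarrow> complex" where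
  "pauli_sign p q = (if fst (snd p) \<and> fst (fst q) then -1 else 1) * (if snd (snd p) \<and> snd (fst q) then -1 else 1)"

lemma pauli_sign_nonzero: "pauli_sign p q \<noteq> 0"
  by (simp add: pauli_sign_def)

lemma pauli_sign_square: "pauli_sign p q * pauli_sign p q = 1"
  by (simp add: pauli_sign_def)

lemma pmat_mult: "pmat p ** pmat q = smul (pauli_sign p q) (pmat (padd p q))"
  by (simp add: pmat_def kron_mult pm1_mult kron_smul_left kron_smul_right padd_def
      pauli_sign_def mult.commute)

lemma pmat_padd: "pmat (padd p q) = smul (pauli_sign p q) (pmat p ** pmat q)"
  by (simp add: pmat_mult pauli_sign_square)

lemma pmat_zero: "pmat pzero = mat 1"
  by (simp add: pmat_def pzero_def pm1_def kron_one)

interpretation padd: abel_semigroup padd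
  by unfold_locales (auto simp: padd_def prod_eq_iff)

lemma padd_zero [simp]: "padd p pzero = p" "padd pzero p = p"
  and padd_self [simp]: "padd p p = pzero"
  and padd_self_left [simp]: "padd p (padd p q) = q"
  by (auto simp: padd_def pzero_def prod_eq_iff)

lemma padd_components [simp]:
  "fst (fst (padd p q)) = (fst (fst p) \<noteq> fst (fst q))"
  "snd (fst (padd p q)) = (snd (fst p) \<noteq> snd (fst q))"
  "fst (snd (padd p q)) = (fst (snd p) \<noteq> fst (snd q))"
  "snd (snd (padd p q)) = (snd (snd p) \<noteq> snd (snd q))"
  by (simp_all add: padd_def)

lemma padd_eq_zero_iff: "padd p q = pzero \<longleftrightarrow> p = q"
  by (auto simp: padd_def pzero_def prod_eq_iff)

lemma pauli_cases: obtains z0 z1 x0 x1 where "(p::pauli) = ((z0,z1),(x0,x1))"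
  by (metis prod.exhaust)

lemma pmat_eq_scalar_imp_zero:
  assumes "pmat r = smul k (mat 1)"
  shows "r = pzero"
proof (cases r rule: pauli_cases)
  case (1 z0 z1 x0 x1)
  with assms show ?thesis
    by (cases z0; cases z1; cases x0; cases x1)
       (auto simp: pmat_def pm1_mat mat2_of_kron id4_mat mat4_of_smul mat4_of_eq_iff pzero_def)
qed

lemma pmat_smul_inj:
  assumes "smul c (pmat p) = smul d (pmat q)" "c \<noteq> 0"
  shows "p = q"
proof -
  have "smul c (pmat p) ** pmat q = smul d (pmat q) ** pmat q"
    using assms by simp
  then have "smul (c * pauli_sign p q) (pmat (padd p q)) = smul (d * pauli_sign q q) (mat 1)"
    by (simp add: smul_mult_left pmat_mult pmat_zero)
  then have "smul (1 / (c * pauli_sign p q)) (smul (c * pauli_sign p q) (pmat (padd p q)))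
           = smul (1 / (c * pauli_sign p q)) (smul (d * pauli_sign q q) (mat 1))"
    by simp
  then have "pmat (padd p q) = smul (d * pauli_sign q q / (c * pauli_sign p q)) (mat 1)"
    using assms(2) pauli_sign_nonzero[of p q] by simp
  then show ?thesis
    using pmat_eq_scalar_imp_zero padd_eq_zero_iff by blast
qed

lemma smul_pmat_cancel:
  assumes "smul c (pmat r) = smul d (pmat r)"
  shows "c = d"
proof -
  have "smul c (pmat r) ** pmat r = smul d (pmat r) ** pmat r"
    using assms by simp
  then have "smul (c * pauli_sign r r) (mat 1) = smul (d * pauli_sign r r) (mat 1 :: mat4)"
    by (simp add: smul_mult_left pmat_mult pmat_zero)
  then have "smul (c * pauli_sign r r) (mat 1) $ (False,False) $ (False,False)
           = smul (d * pauli_sign r r) (mat 1 :: mat4) $ (False,False) $ (False,False)"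
    by (rule arg_cong)
  then show ?thesis
    by (simp add: smul_def mat_def pauli_sign_nonzero)
qed

lemma modphase_smul_pmat: "c \<noteq> 0 \<Longrightarrow> modphase (smul c (pmat q)) = q"
  unfolding modphase_def by (rule the_equality) (auto dest: pmat_smul_inj)

definition symp_form :: "pauli \<Rightarrow> pauli \<Rightarrow> bool" where
  "symp_form p q \<longleftrightarrow>
     ((fst (fst p) \<and> fst (snd q)) \<noteq> (fst (snd p) \<and> fst (fst q))) \<noteq>
     ((snd (fst p) \<and> snd (snd q)) \<noteq> (snd (snd p) \<and> snd (fst q)))"

lemma lam_eq_symp_form: "lam p q = symp_form p q"
proof -
  have "lam p q \<longleftrightarrow> smul (pauli_sign p q) (pmat (padd p q)) \<noteq> smul (pauli_sign q p) (pmat (padd p q))"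
    unfolding lam_def pmat_mult by (simp add: padd.commute)
  also have "\<dots> \<longleftrightarrow> pauli_sign p q \<noteq> pauli_sign q p"
    by (auto dest: smul_pmat_cancel)
  also have "\<dots> \<longleftrightarrow> symp_form p q"
    by (auto simp: pauli_sign_def symp_form_def)
  finally show ?thesis .
qed

lemma lam_padd_left: "lam (padd p q) s = (lam p s \<noteq> lam q s)"
  by (auto simp: lam_eq_symp_form symp_form_def padd_def)

definition pauli_linear :: "(pauli \<Rightarrow> pauli) \<Rightarrow> bool" where
  "pauli_linear h \<longleftrightarrow> (\<forall>p q. h (padd p q) = padd (h p) (h q))"

definition sel :: "bool \<Rightarrow> pauli \<Rightarrow> pauli" where
  "sel b p = (if b then p else pzero)"

lemma phi_sel:
  "phi B p = padd (padd (sel (fst (fst p)) (fst (fst B))) (sel (snd (fst p)) (fst (snd B))))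
                  (padd (sel (fst (snd p)) (snd (fst B))) (sel (snd (snd p)) (snd (snd B))))"
  by (simp add: phi_def sel_def fr_def)

lemma sel_xor: "sel (a \<noteq> b) u = padd (sel a u) (sel b u)" "sel (a = (\<not> b)) u = padd (sel a u) (sel b u)"
  by (cases a; cases b; simp add: sel_def)+

lemma pauli_linear_phi: "pauli_linear (phi B)"
  unfolding pauli_linear_def phi_sel
  by (simp add: sel_xor padd.assoc padd.commute padd.left_commute)

lemma pauli_linear_zero: "pauli_linear h \<Longrightarrow> h pzero = pzero"
  by (metis padd_self pauli_linear_def)

lemma pauli_linear_comp: "pauli_linear h \<Longrightarrow> pauli_linear k \<Longrightarrow> pauli_linear (h \<circ> k)"
  by (metis comp_apply pauli_linear_def)

lemma phi_B0 [simp]: "phi B0 p = p"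
  by (cases p rule: pauli_cases)
     (simp add: phi_sel sel_def B0_def Zq_def Xq_def bit2_def padd_def pzero_def)

lemma pauli_decomp:
  "p = padd (padd (sel (fst (fst p)) (Zq 0)) (sel (snd (fst p)) (Zq 1)))
            (padd (sel (fst (snd p)) (Xq 0)) (sel (snd (snd p)) (Xq 1)))"
  using phi_B0[of p] by (simp add: phi_sel B0_def)

definition frame_of :: "(pauli \<Rightarrow> pauli) \<Rightarrow> frame" where
  "frame_of f = ((f (Zq 0), f (Xq 0)), (f (Zq 1), f (Xq 1)))"

lemma phi_frame_of: "pauli_linear f \<Longrightarrow> phi (frame_of f) = f"
proof
  fix p :: pauli
  assume f: "pauli_linear f"
  have lin: "f (padd q r) = padd (f q) (f r)" for q r
    using f unfolding pauli_linear_def by blast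
  have sel: "f (sel b u) = sel b (f u)" for b u
    using pauli_linear_zero[OF f] by (simp add: sel_def)
  have "f p = f (padd (padd (sel (fst (fst p)) (Zq 0)) (sel (snd (fst p)) (Zq 1)))
                      (padd (sel (fst (snd p)) (Xq 0)) (sel (snd (snd p)) (Xq 1))))"
    using pauli_decomp[of p] by simp
  also have "\<dots> = phi (frame_of f) p"
    by (simp add: lin sel phi_sel frame_of_def)
  finally show "phi (frame_of f) p = f p" by simp
qed

definition frame_act :: "(pauli \<Rightarrow> pauli) \<Rightarrow> frame \<Rightarrow> frame" where
  "frame_act h B = frame_of (phi B \<circ> h)"

lemma frame_act_id: "frame_act id B = B"
  by (simp add: frame_act_def frame_of_def phi_def fr_def Zq_def Xq_def bit2_def)

lemma frame_act_frame_of: "pauli_linear f \<Longrightarrow> frame_act h (frame_of f) = frame_of (f \<circ> h)"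
  by (simp add: frame_act_def phi_frame_of)

lemma frame_act_frame_act: "pauli_linear h \<Longrightarrow> frame_act k (frame_act h B) = frame_act (h \<circ> k) B"
  by (simp add: frame_act_def phi_frame_of pauli_linear_comp pauli_linear_phi comp_assoc)

lemma frame_act_B0: "frame_act h B0 = frame_of h"
  by (simp add: frame_act_def comp_def)

section \<open>Clifford conjugation\<close>

definition pauli_conj :: "mat4 \<Rightarrow> (pauli \<Rightarrow> pauli) \<Rightarrow> bool" where
  "pauli_conj V h \<longleftrightarrow> (\<forall>p. \<exists>c. c \<noteq> 0 \<and> adj V ** pmat p ** V = smul c (pmat (h p)))"

lemma bact_pauli_conj:
  assumes "pauli_conj V h"
  shows "bact V = frame_act h"
proof -
  have "modphase (adj V ** pmat p ** V) = h p" for p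
    using assms modphase_smul_pmat unfolding pauli_conj_def by metis
  then show ?thesis
    by (simp add: fun_eq_iff bact_def frame_act_def frame_of_def)
qed

lemma pauli_conj_one: "pauli_conj (mat 1) id"
  unfolding pauli_conj_def by (intro allI exI[of _ 1]) simp

lemma pauli_conj_mult:
  assumes "pauli_conj A h" "pauli_conj B k"
  shows "pauli_conj (A ** B) (k \<circ> h)"
  unfolding pauli_conj_def
proof
  fix p
  obtain c where c: "c \<noteq> 0" "adj A ** pmat p ** A = smul c (pmat (h p))"
    using assms(1) unfolding pauli_conj_def by blast
  obtain d where d: "d \<noteq> 0" "adj B ** pmat (h p) ** B = smul d (pmat (k (h p)))"
    using assms(2) unfolding pauli_conj_def by blast
  have "adj (A ** B) ** pmat p ** (A ** B) = adj B ** (adj A ** pmat p ** A) ** B"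
    by (simp add: adj_mult matrix_mul_assoc)
  also have "\<dots> = smul (c * d) (pmat (k (h p)))"
    by (simp add: c d smul_mult_left smul_mult_right)
  finally show "\<exists>e. e \<noteq> 0 \<and> adj (A ** B) ** pmat p ** (A ** B) = smul e (pmat ((k \<circ> h) p))"
    using c(1) d(1) by (intro exI[of _ "c * d"]) simp
qed

lemma unitary_conj_padd:
  assumes V: "unitary V"
    and p: "a \<noteq> 0" "adj V ** pmat p ** V = smul a (pmat p')"
    and q: "b \<noteq> 0" "adj V ** pmat q ** V = smul b (pmat q')"
  shows "\<exists>c. c \<noteq> 0 \<and> adj V ** pmat (padd p q) ** V = smul c (pmat (padd p' q'))"
proof -
  let ?c = "pauli_sign p q * a * b * pauli_sign p' q'"
  have "adj V ** pmat (padd p q) ** V = smul (pauli_sign p q) (adj V ** (pmat p ** pmat q) ** V)"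
    by (subst pmat_padd) (simp only: smul_mult_left smul_mult_right)
  also have "\<dots> = smul ?c (pmat (padd p' q'))"
    by (simp only: unitary_conj_mult[OF V])
       (simp add: p q smul_mult_left smul_mult_right pmat_mult mult_ac)
  finally show ?thesis
    using p(1) q(1) pauli_sign_nonzero by (intro exI[of _ ?c]) simp
qed

lemma pauli_conj_linear:
  assumes V: "unitary V" and h: "pauli_conj V h"
  shows "pauli_linear h"
  unfolding pauli_linear_def
proof (intro allI)
  fix p q
  obtain a b where "a \<noteq> 0" "adj V ** pmat p ** V = smul a (pmat (h p))"
    and "b \<noteq> 0" "adj V ** pmat q ** V = smul b (pmat (h q))"
    using h unfolding pauli_conj_def by blast
  then obtain c where c: "c \<noteq> 0" "adj V ** pmat (padd p q) ** V = smul c (pmat (padd (h p) (h q)))"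
    using unitary_conj_padd[OF V] by blast
  obtain d where "adj V ** pmat (padd p q) ** V = smul d (pmat (h (padd p q)))"
    using h unfolding pauli_conj_def by blast
  with c show "h (padd p q) = padd (h p) (h q)"
    by (metis pmat_smul_inj)
qed

lemma pauli_conj_basisI:
  assumes V: "unitary V" and h: "pauli_linear h"
    and basis: "\<And>b. b \<in> {Zq 0, Xq 0, Zq 1, Xq 1} \<Longrightarrow>
                  \<exists>c. c \<noteq> 0 \<and> adj V ** pmat b ** V = smul c (pmat (h b))"
  shows "pauli_conj V h"
proof -
  define good where "good p \<longleftrightarrow> (\<exists>c. c \<noteq> 0 \<and> adj V ** pmat p ** V = smul c (pmat (h p)))" for p
  have add: "good (padd p q)" if "good p" "good q" for p q
    using that unitary_conj_padd[OF V] h unfolding good_def pauli_linear_def by metis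
  have "good pzero"
    using V pauli_linear_zero[OF h] unfolding good_def unitary_def
    by (intro exI[of _ 1]) (simp add: pmat_zero)
  then have sel: "good (sel a b)" if "b \<in> {Zq 0, Xq 0, Zq 1, Xq 1}" for a b
    using basis[OF that] unfolding good_def sel_def by simp
  have "good p" for p
    by (subst pauli_decomp) (intro add sel; simp)
  then show ?thesis
    unfolding pauli_conj_def good_def by blast
qed

lemma pauli_conj_inj:
  assumes U: "unitary A" and h: "pauli_conj A h"
  shows "inj h"
proof (rule injI)
  fix p q
  assume e: "h p = h q"
  obtain a where a: "a \<noteq> 0" "adj A ** pmat p ** A = smul a (pmat (h p))"
    using h unfolding pauli_conj_def by blast
  obtain b where b: "adj A ** pmat q ** A = smul b (pmat (h q))"
    using h unfolding pauli_conj_def by blast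
  have "A ** smul b (adj A ** pmat p ** A) ** adj A = A ** smul a (adj A ** pmat q ** A) ** adj A"
    using a(2) b e by (simp add: mult.commute)
  then have "smul b (pmat p) = smul a (pmat q)"
    by (simp only: smul_mult_left smul_mult_right unitary_conj_cancel[OF U])
  with a(1) show "p = q"
    by (metis pmat_smul_inj)
qed

lemma pauli_conj_adj:
  assumes U: "unitary A" and h: "pauli_conj A h"
  shows "pauli_conj (adj A) (inv h)"
  unfolding pauli_conj_def
proof
  fix q
  have "surj h"
    using pauli_conj_inj[OF U h] finite_UNIV_inj_surj[of h] by simp
  then have hq: "h (inv h q) = q"
    by (simp add: surj_f_inv_f)
  obtain a where a: "a \<noteq> 0" "adj A ** pmat (inv h q) ** A = smul a (pmat q)"
    using h hq unfolding pauli_conj_def by metis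
  have "pmat (inv h q) = smul a (A ** pmat q ** adj A)"
    using unitary_conj_cancel(1)[OF U, of "pmat (inv h q)"] a(2)
    by (simp add: smul_mult_left smul_mult_right)
  with a(1) show "\<exists>c. c \<noteq> 0 \<and> adj (adj A) ** pmat q ** adj A = smul c (pmat (inv h q))"
    by (intro exI[of _ "1 / a"]) simp
qed

lemma pauli_conj_lam:
  assumes V: "unitary V" and h: "pauli_conj V h"
  shows "lam (h p) (h q) = lam p q"
proof -
  obtain c where c: "c \<noteq> 0" "adj V ** pmat p ** V = smul c (pmat (h p))"
    using h unfolding pauli_conj_def by blast
  obtain d where d: "d \<noteq> 0" "adj V ** pmat q ** V = smul d (pmat (h q))"
    using h unfolding pauli_conj_def by blast
  have pq: "adj V ** (pmat p ** pmat q) ** V = smul (c * d) (pmat (h p) ** pmat (h q))"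
    and qp: "adj V ** (pmat q ** pmat p) ** V = smul (c * d) (pmat (h q) ** pmat (h p))"
    by (simp_all add: unitary_conj_mult[OF V] c d smul_mult_left smul_mult_right mult.commute)
  have "pmat p ** pmat q = pmat q ** pmat p \<longleftrightarrow>
        adj V ** (pmat p ** pmat q) ** V = adj V ** (pmat q ** pmat p) ** V"
    by (metis unitary_conj_cancel(1)[OF V])
  also have "\<dots> \<longleftrightarrow> pmat (h p) ** pmat (h q) = pmat (h q) ** pmat (h p)"
    unfolding pq qp using c(1) d(1) by (simp add: smul_cancel)
  finally show ?thesis
    unfolding lam_def by simp
qed

section \<open>Local Clifford maps\<close>

text \<open>On the bits \<open>(z, x)\<close> of a one-qubit Pauli \<open>Z\<^sup>z X\<^sup>x\<close>, Hadamard acts by \<open>prod.swap\<close> and the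
  phase gate by \<open>shear\<close>.\<close>

definition shear :: "bool \<times> bool \<Rightarrow> bool \<times> bool" where
  "shear q = (fst q \<noteq> snd q, snd q)"

definition pswap :: "pauli \<Rightarrow> pauli" where
  "pswap = map_prod prod.swap prod.swap"

definition lift0 :: "(bool \<times> bool \<Rightarrow> bool \<times> bool) \<Rightarrow> pauli \<Rightarrow> pauli" where
  "lift0 g p = ((fst (g (fst (fst p), fst (snd p))), snd (fst p)), (snd (g (fst (fst p), fst (snd p))), snd (snd p)))"

definition lift1 :: "(bool \<times> bool \<Rightarrow> bool \<times> bool) \<Rightarrow> pauli \<Rightarrow> pauli" where
  "lift1 g = pswap \<circ> lift0 g \<circ> pswap"

lemma lift0_comp: "lift0 (f \<circ> g) = lift0 f \<circ> lift0 g"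
  by (simp add: fun_eq_iff lift0_def)

lemma lift0_id: "lift0 id = id"
  by (simp add: fun_eq_iff lift0_def)

lemma pswap_pswap [simp]: "pswap (pswap p) = p"
  by (cases p) (simp add: pswap_def)

lemma lift1_comp: "lift1 (f \<circ> g) = lift1 f \<circ> lift1 g"
  by (simp add: lift1_def lift0_comp fun_eq_iff)

lemma lift1_id: "lift1 id = id"
  by (simp add: lift1_def lift0_id fun_eq_iff)

definition local_gens :: "(pauli \<Rightarrow> pauli) set" where
  "local_gens = {pswap, lift0 prod.swap, lift1 prod.swap, lift0 shear, lift1 shear}"

inductive_set local_maps :: "(pauli \<Rightarrow> pauli) set" where
  local_maps_id: "id \<in> local_maps"
| local_maps_step: "s \<in> local_gens \<Longrightarrow> h \<in> local_maps \<Longrightarrow> h \<circ> s \<in> local_maps"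

lemma local_gens_involution:
  assumes "s \<in> local_gens"
  shows "s \<circ> s = id"
proof -
  have sw: "prod.swap \<circ> prod.swap = id" and sh: "shear \<circ> shear = id"
    by (auto simp: fun_eq_iff shear_def)
  have "lift0 prod.swap \<circ> lift0 prod.swap = id" "lift0 shear \<circ> lift0 shear = id"
    "lift1 prod.swap \<circ> lift1 prod.swap = id" "lift1 shear \<circ> lift1 shear = id"
    by (simp_all only: lift0_comp[symmetric] lift1_comp[symmetric] sw sh lift0_id lift1_id)
  moreover have "pswap \<circ> pswap = id"
    by (simp add: fun_eq_iff)
  ultimately show ?thesis
    using assms unfolding local_gens_def by (elim insertE emptyE) simp_all
qed

lemma local_gens_linear: "s \<in> local_gens \<Longrightarrow> pauli_linear s"
  unfolding local_gens_def pauli_linear_def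
  by (auto simp: lift1_def lift0_def pswap_def shear_def padd_def)

lemma local_maps_linear: "h \<in> local_maps \<Longrightarrow> pauli_linear h"
proof (induction rule: local_maps.induct)
  case local_maps_id
  show ?case by (simp add: pauli_linear_def)
next
  case (local_maps_step s h)
  then show ?case using pauli_linear_comp local_gens_linear by blast
qed

lemma local_gens_in_local_maps: "s \<in> local_gens \<Longrightarrow> s \<in> local_maps"
  using local_maps_step[OF _ local_maps_id] by fastforce

lemma local_maps_comp:
  assumes "h \<in> local_maps" "k \<in> local_maps"
  shows "h \<circ> k \<in> local_maps"
  using assms(2)
proof induction
  case local_maps_id
  show ?case using assms(1) by simp
next
  case (local_maps_step s k)
  show ?case
    unfolding comp_assoc[symmetric]
    by (rule local_maps.local_maps_step[OF local_maps_step.hyps(1) local_maps_step.IH])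
qed

lemma local_maps_bij: "h \<in> local_maps \<Longrightarrow> bij h"
proof (induction rule: local_maps.induct)
  case local_maps_id
  show ?case by (rule bij_id)
next
  case (local_maps_step s h)
  then show ?case by (metis bij_comp local_gens_involution o_bij)
qed

lemma local_maps_inv: "h \<in> local_maps \<Longrightarrow> inv h \<in> local_maps"
proof (induction rule: local_maps.induct)
  case local_maps_id
  show ?case by (simp only: inv_id) (rule local_maps.local_maps_id)
next
  case (local_maps_step s h)
  have "inv (h \<circ> s) = s \<circ> inv h"
    using local_maps_bij[OF local_gens_in_local_maps[OF local_maps_step.hyps(1)]]
      local_maps_bij[OF local_maps_step.hyps(2)] local_gens_involution[OF local_maps_step.hyps(1)]
    by (simp add: o_inv_distrib inv_unique_comp)
  moreover have "s \<circ> inv h \<in> local_maps"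
    using local_maps_comp[OF local_gens_in_local_maps[OF local_maps_step.hyps(1)] local_maps_step.IH] .
  ultimately show ?case
    by (simp only:)
qed

text \<open>On one qubit every permutation of \<open>X, Y, Z\<close> is symplectic, and \<open>prod.swap\<close> and \<open>shear\<close>
  generate all six of them.\<close>

lemma one_qubit_symplectic_cases:
  assumes "inj g" "g (False,False) = (False,False)"
  shows "g \<in> {id, prod.swap, shear, prod.swap \<circ> shear \<circ> prod.swap, prod.swap \<circ> shear, shear \<circ> prod.swap}"
proof -
  have d: "g (True,False) \<noteq> g (False,False)" "g (False,True) \<noteq> g (False,False)"
    "g (True,True) \<noteq> g (False,False)" "g (True,False) \<noteq> g (False,True)"
    "g (True,False) \<noteq> g (True,True)" "g (False,True) \<noteq> g (True,True)"
    by (simp_all add: inj_eq[OF assms(1)])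
  obtain a1 a2 b1 b2 c1 c2 where
    "g (True,False) = (a1,a2)" "g (False,True) = (b1,b2)" "g (True,True) = (c1,c2)"
    by (metis surj_pair)
  with d assms(2) show ?thesis
    by (cases a1; cases a2; cases b1; cases b2; cases c1; cases c2)
       (simp_all add: fun_eq_iff all_bool_eq shear_def)
qed

lemma lift_local_maps:
  assumes "inj g" "g (False,False) = (False,False)"
  shows "lift0 g \<in> local_maps \<and> lift1 g \<in> local_maps"
proof -
  have gens: "lift0 prod.swap \<in> local_maps" "lift0 shear \<in> local_maps"
    "lift1 prod.swap \<in> local_maps" "lift1 shear \<in> local_maps"
    by (simp_all add: local_gens_in_local_maps local_gens_def)
  from one_qubit_symplectic_cases[OF assms] show ?thesis
    by (elim insertE emptyE; simp only: lift0_comp lift0_id lift1_comp lift1_id)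
       (intro conjI local_maps_comp gens local_maps_id)+
qed

lemma inj_of_inj_lift:
  assumes "inj (lift0 g) \<or> inj (lift1 g)"
  shows "inj g"
proof (rule injI)
  fix q r
  assume "g q = g r"
  then have "lift0 g ((fst q, False), (snd q, False)) = lift0 g ((fst r, False), (snd r, False))"
    and "lift1 g ((False, fst q), (False, snd q)) = lift1 g ((False, fst r), (False, snd r))"
    by (simp_all add: lift0_def lift1_def pswap_def)
  with assms have "((fst q, False), (snd q, False)) = ((fst r, False), (snd r, False))
                 \<or> ((False, fst q), (False, snd q)) = ((False, fst r), (False, snd r))"
    by (meson injD)
  then show "q = r"
    by (simp add: prod_eq_iff)
qed

lemma fixes_zero_of_lift:
  assumes "lift0 g pzero = pzero \<or> lift1 g pzero = pzero"
  shows "g (False,False) = (False,False)"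
  using assms by (auto simp: lift0_def lift1_def pswap_def pzero_def prod_eq_iff)

lemma hadamard_conj: "adj hadamard ** pm1 z x ** hadamard = smul (if z \<and> x then -1 else 1) (pm1 x z)"
proof -
  let ?r = "complex_of_real (1 / sqrt 2)"
  have r: "complex_of_real (sqrt 2) * complex_of_real (sqrt 2) = 2"
    by (simp flip: of_real_mult)
  have H: "hadamard = mat2_of ?r ?r ?r (- ?r)"
    by (simp add: mat2_eq_iff mat2_of_def hadamard_def)
  show ?thesis
    by (cases z; cases x) (simp_all add: H pm1_mat mat2_of_adj mat2_of_mult mat2_of_smul mat2_of_eq_iff r algebra_simps)
qed

lemma phaseP_conj: "adj phaseP ** pm1 z x ** phaseP = smul (if x then \<i> else 1) (pm1 (z \<noteq> x) x)"
proof -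
  have "cis (pi/4) * cis (pi/4) = cis (pi/2)" "cis (-(pi/4)) * cis (-(pi/4)) = cnj (cis (pi/2))"
    by (simp_all add: cis_mult cis_cnj)
  then have w: "cis (pi/4) * cis (pi/4) = \<i>" "cis (-(pi/4)) * cis (-(pi/4)) = -\<i>"
    "cis (pi/4) * cis (-(pi/4)) = 1" "cis (-(pi/4)) * cis (pi/4) = 1"
    "cnj (cis (pi/4)) = cis (-(pi/4))" "cnj (cis (-(pi/4))) = cis (pi/4)"
    by (simp_all add: cis_mult cis_cnj)
  have P: "phaseP = mat2_of (cis (-(pi/4))) 0 0 (cis (pi/4))"
    by (simp add: mat2_eq_iff mat2_of_def phaseP_def)
  show ?thesis
    by (cases z; cases x) (simp_all add: P pm1_mat mat2_of_adj mat2_of_mult mat2_of_smul mat2_of_eq_iff w algebra_simps)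
qed

lemma pauli_conj_kron0:
  assumes g: "\<And>z x. \<exists>c. c \<noteq> 0 \<and> adj U ** pm1 z x ** U = smul c (case_prod pm1 (g (z,x)))"
  shows "pauli_conj (kron U (mat 1)) (lift0 g)"
  unfolding pauli_conj_def
proof
  fix p :: pauli
  obtain c where c: "c \<noteq> 0"
    "adj U ** pm1 (fst (fst p)) (fst (snd p)) ** U = smul c (case_prod pm1 (g (fst (fst p), fst (snd p))))"
    using g by blast
  have "adj (kron U (mat 1)) ** pmat p ** kron U (mat 1)
        = kron (adj U ** pm1 (fst (fst p)) (fst (snd p)) ** U) (pm1 (snd (fst p)) (snd (snd p)))"
    by (simp add: adj_kron pmat_def kron_mult)
  also have "\<dots> = smul c (pmat (lift0 g p))"
    using c(2) by (simp add: kron_smul_left pmat_def lift0_def split_beta)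
  finally show "\<exists>c. c \<noteq> 0 \<and> adj (kron U (mat 1)) ** pmat p ** kron U (mat 1) = smul c (pmat (lift0 g p))"
    using c(1) by blast
qed

lemma pauli_conj_SWAP: "pauli_conj SWAP pswap"
  unfolding pauli_conj_def
proof
  fix p :: pauli
  show "\<exists>c. c \<noteq> 0 \<and> adj SWAP ** pmat p ** SWAP = smul c (pmat (pswap p))"
    by (intro exI[of _ 1]) (simp add: adj_SWAP pmat_def SWAP_conj_kron pswap_def split_beta)
qed

lemma pauli_conj_kron1:
  assumes "\<And>z x. \<exists>c. c \<noteq> 0 \<and> adj U ** pm1 z x ** U = smul c (case_prod pm1 (g (z,x)))"
  shows "pauli_conj (kron (mat 1) U) (lift1 g)"
proof -
  have "pauli_conj (SWAP ** kron U (mat 1) ** SWAP) (pswap \<circ> (lift0 g \<circ> pswap))"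
    by (intro pauli_conj_mult pauli_conj_SWAP pauli_conj_kron0 assms)
  then show ?thesis
    by (simp add: SWAP_conj_kron lift1_def comp_assoc)
qed

lemma bact_egens: "bact ` egens = frame_act ` local_gens"
proof -
  have H: "\<exists>c. c \<noteq> 0 \<and> adj hadamard ** pm1 z x ** hadamard = smul c (case_prod pm1 (prod.swap (z,x)))"
    for z x by (intro exI[of _ "if z \<and> x then -1 else 1"]) (simp add: hadamard_conj)
  have P: "\<exists>c. c \<noteq> 0 \<and> adj phaseP ** pm1 z x ** phaseP = smul c (case_prod pm1 (shear (z,x)))"
    for z x by (intro exI[of _ "if x then \<i> else 1"]) (simp add: phaseP_conj shear_def)
  have "bact SWAP = frame_act pswap"
    "bact (kron hadamard (mat 1)) = frame_act (lift0 prod.swap)" "bact (kron (mat 1) hadamard) = frame_act (lift1 prod.swap)"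
    "bact (kron phaseP (mat 1)) = frame_act (lift0 shear)" "bact (kron (mat 1) phaseP) = frame_act (lift1 shear)"
    by (intro bact_pauli_conj pauli_conj_SWAP pauli_conj_kron0 pauli_conj_kron1 H P)+
  then show ?thesis
    by (simp add: egens_def local_gens_def)
qed


lemma clifford1_conj:
  assumes "clifford1 U"
  shows "\<exists>g. \<forall>z x. \<exists>c. c \<noteq> 0 \<and> U ** pm1 z x ** adj U = smul c (case_prod pm1 (g (z,x)))"
proof -
  have U: "unitary U"
    using assms unfolding clifford1_def by blast
  have "\<exists>r c. c \<noteq> 0 \<and> U ** pm1 (fst q) (snd q) ** adj U = smul c (case_prod pm1 r)" for q
  proof -
    obtain z' x' c where e: "U ** pm1 (fst q) (snd q) ** adj U = smul c (pm1 z' x')"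
      using assms unfolding clifford1_def by blast
    have "c \<noteq> 0"
    proof
      assume "c = 0"
      then have "pm1 (fst q) (snd q) = smul 0 (adj U ** pm1 z' x' ** U)"
        using unitary_conj_cancel(2)[OF U, of "pm1 (fst q) (snd q)"] e
        by (simp add: smul_mult_left smul_mult_right)
      then show False
        using pm1_neq_smul_zero by blast
    qed
    with e show ?thesis
      by (intro exI[of _ "(z',x')"] exI[of _ c]) simp
  qed
  then obtain g where "\<forall>q. \<exists>c. c \<noteq> 0 \<and> U ** pm1 (fst q) (snd q) ** adj U = smul c (case_prod pm1 (g q))"
    by metis
  then show ?thesis
    by (metis fst_conv snd_conv)
qed

lemma local_gate_conj:
  assumes K: "unitary K" and f: "pauli_conj (adj K) f" and lift: "f = lift0 g \<or> f = lift1 g"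
  shows "\<exists>h\<in>local_maps. pauli_conj K h"
proof -
  have "inj f" "f pzero = pzero"
    using pauli_conj_inj[OF unitary_adj[OF K] f] pauli_linear_zero[OF pauli_conj_linear[OF unitary_adj[OF K] f]]
    by simp_all
  with lift have "inj g" "g (False,False) = (False,False)"
    using inj_of_inj_lift fixes_zero_of_lift by blast+
  with lift have "f \<in> local_maps"
    using lift_local_maps by blast
  moreover have "pauli_conj K (inv f)"
    using pauli_conj_adj[OF unitary_adj[OF K] f] by simp
  ultimately show ?thesis
    using local_maps_inv by blast
qed

lemma LocCliff_conj: "L \<in> LocCliff \<Longrightarrow> unitary L \<and> (\<exists>h\<in>local_maps. pauli_conj L h)"
proof (induction rule: LocCliff.induct)
  case LC_one
  show ?case using unitary_one pauli_conj_one local_maps_id by blast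
next
  case LC_swap
  show ?case
    using unitary_SWAP pauli_conj_SWAP local_gens_in_local_maps[of pswap] by (auto simp: local_gens_def)
next
  case (LC_q0 U)
  obtain g where "\<And>z x. \<exists>c. c \<noteq> 0 \<and> U ** pm1 z x ** adj U = smul c (case_prod pm1 (g (z,x)))"
    using clifford1_conj[OF LC_q0] by blast
  then have "pauli_conj (kron (adj U) (mat 1)) (lift0 g)"
    by (intro pauli_conj_kron0) simp
  then have "pauli_conj (adj (kron U (mat 1))) (lift0 g)"
    by (simp add: adj_kron)
  moreover have "unitary (kron U (mat 1))"
    using LC_q0 unitary_kron unitary_one unfolding clifford1_def by blast
  ultimately show ?case
    using local_gate_conj by blast
next
  case (LC_q1 U)
  obtain g where "\<And>z x. \<exists>c. c \<noteq> 0 \<and> U ** pm1 z x ** adj U = smul c (case_prod pm1 (g (z,x)))"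
    using clifford1_conj[OF LC_q1] by blast
  then have "pauli_conj (kron (mat 1) (adj U)) (lift1 g)"
    by (intro pauli_conj_kron1) simp
  then have "pauli_conj (adj (kron (mat 1) U)) (lift1 g)"
    by (simp add: adj_kron)
  moreover have "unitary (kron (mat 1) U)"
    using LC_q1 unitary_kron unitary_one unfolding clifford1_def by blast
  ultimately show ?case
    using local_gate_conj by blast
next
  case (LC_mult A B)
  then show ?case
    using pauli_conj_mult local_maps_comp unitary_mult by blast
next
  case (LC_adj A)
  then show ?case
    using pauli_conj_adj local_maps_inv unitary_adj by blast
qed

section \<open>EEF classes\<close>

lemma frame_act_local_gens_involution: "s \<in> local_gens \<Longrightarrow> frame_act s (frame_act s F) = F"
  by (simp add: frame_act_frame_act local_gens_linear local_gens_involution frame_act_id)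

lemma inv_bact_egens:
  assumes "g \<in> egens"
  shows "inv (bact g) = bact g"
proof -
  have "bact g \<in> frame_act ` local_gens"
    using assms bact_egens by blast
  then obtain s where s: "s \<in> local_gens" "bact g = frame_act s"
    by blast
  show ?thesis
    unfolding s(2) by (rule inv_unique_comp) (simp_all add: fun_eq_iff frame_act_local_gens_involution[OF s(1)])
qed

lemma frame_act_id_fun: "frame_act id = id"
  by (simp add: fun_eq_iff frame_act_id)

lemma bact_egens_comp:
  assumes "g \<in> egens" "h \<in> local_maps"
  shows "\<exists>h'\<in>local_maps. bact g \<circ> frame_act h = frame_act h'"
proof -
  have "bact g \<in> frame_act ` local_gens"
    using assms(1) bact_egens by blast
  then obtain s where s: "s \<in> local_gens" "bact g = frame_act s"
    by blast
  have "bact g \<circ> frame_act h = frame_act (h \<circ> s)"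
    by (simp add: fun_eq_iff s(2) frame_act_frame_act local_maps_linear[OF assms(2)])
  then show ?thesis
    using local_maps_step[OF s(1) assms(2)] by blast
qed

lemma Ebar_frame_act: "\<gamma> \<in> Ebar \<Longrightarrow> \<exists>h\<in>local_maps. \<gamma> = frame_act h"
proof (induction rule: Ebar.induct)
  case Ebar_id
  show ?case
    by (rule bexI[of _ id]) (simp_all only: frame_act_id_fun local_maps_id)
next
  case (Ebar_gen \<gamma> g)
  then obtain h where "h \<in> local_maps" "\<gamma> = frame_act h"
    by blast
  with bact_egens_comp[OF Ebar_gen.hyps(2)] show ?case
    by blast
next
  case (Ebar_inv \<gamma> g)
  then obtain h where "h \<in> local_maps" "\<gamma> = frame_act h"
    by blast
  with bact_egens_comp[OF Ebar_inv.hyps(2)] show ?case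
    unfolding inv_bact_egens[OF Ebar_inv.hyps(2)] by blast
qed

lemma frame_act_in_Ebar: "h \<in> local_maps \<Longrightarrow> frame_act h \<in> Ebar"
proof (induction rule: local_maps.induct)
  case local_maps_id
  show ?case
    using Ebar_id frame_act_id_fun by (simp add: id_def)
next
  case (local_maps_step s h)
  have "frame_act s \<in> bact ` egens"
    using local_maps_step.hyps(1) bact_egens by blast
  then obtain g where g: "g \<in> egens" "frame_act s = bact g"
    by blast
  have "frame_act (h \<circ> s) = bact g \<circ> frame_act h"
    by (simp add: fun_eq_iff frame_act_frame_act local_maps_linear[OF local_maps_step.hyps(2)] g(2)[symmetric])
  with Ebar_gen[OF local_maps_step.IH g(1)] show ?case
    by (simp only:)
qed

lemma eef_class_eq: "eef_class F = (\<lambda>h. frame_act h F) ` local_maps"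
  unfolding eef_class_def using Ebar_frame_act frame_act_in_Ebar by blast

lemma frame_act_local_gens:
  "frame_act pswap ((a,b),(c,d)) = ((c,d),(a,b))"
  "frame_act (lift0 prod.swap) ((a,b),(c,d)) = ((b,a),(c,d))"
  "frame_act (lift1 prod.swap) ((a,b),(c,d)) = ((a,b),(d,c))"
  "frame_act (lift0 shear) ((a,b),(c,d)) = ((a, padd a b),(c,d))"
  "frame_act (lift1 shear) ((a,b),(c,d)) = ((a,b),(c, padd c d))"
  by (simp_all add: frame_act_def frame_of_def phi_def fr_def Zq_def Xq_def bit2_def lift1_def lift0_def
      pswap_def shear_def)

text \<open>\<open>plane_mask a b\<close> is the bitmask of the set \<open>{a, b, ab}\<close>, so \<open>frame_key\<close> is the unordered
  pair of planes of a frame.\<close>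

definition pauli_code :: "pauli \<Rightarrow> nat" where
  "pauli_code p = of_bool (fst (fst p)) + 2 * of_bool (snd (fst p)) + 4 * of_bool (fst (snd p))
                  + 8 * of_bool (snd (snd p))"

definition plane_mask :: "pauli \<Rightarrow> pauli \<Rightarrow> nat" where
  "plane_mask a b = 2 ^ pauli_code a + 2 ^ pauli_code b + 2 ^ pauli_code (padd a b)"

definition frame_key :: "frame \<Rightarrow> nat set" where
  "frame_key F = {plane_mask (fst (fst F)) (snd (fst F)), plane_mask (fst (snd F)) (snd (snd F))}"

lemma plane_mask_commute: "plane_mask b a = plane_mask a b"
  by (simp add: plane_mask_def padd.commute add_ac)

lemma plane_mask_padd: "plane_mask a (padd a b) = plane_mask a b"
  by (simp add: plane_mask_def add_ac)

lemma frame_key_act_local_gens: "s \<in> local_gens \<Longrightarrow> frame_key (frame_act s F) = frame_key F"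
  by (cases F rule: prod.exhaust[case_product prod.exhaust prod.exhaust], unfold local_gens_def)
     (auto simp: frame_act_local_gens frame_key_def plane_mask_commute plane_mask_padd)

lemma frame_key_act: "h \<in> local_maps \<Longrightarrow> frame_key (frame_act h F) = frame_key F"
proof (induction arbitrary: F rule: local_maps.induct)
  case local_maps_id
  show ?case by (simp only: frame_act_id)
next
  case (local_maps_step s h)
  have "frame_act (h \<circ> s) F = frame_act s (frame_act h F)"
    using frame_act_frame_act[OF local_maps_linear[OF local_maps_step.hyps(2)], of s F] by simp
  then show ?case
    by (simp only: frame_key_act_local_gens[OF local_maps_step.hyps(1)] local_maps_step.IH)
qed

lemma eef_class_key: "eef_class F = eef_class F' \<Longrightarrow> frame_key F = frame_key F'"
  by (metis (no_types, lifting) eef_class_eq frame_key_act image_iff local_maps_id frame_act_id)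

section \<open>Controlled Pauli gates\<close>

text \<open>For \<open>C(\<sigma>,\<tau>)\<^sub>0\<^sub>1\<close> the arguments of \<open>ctrl_map\<close> are \<open>s = \<sigma>\<^sub>0\<close> and \<open>t = \<tau>\<^sub>1\<close>.\<close>

definition ctrl_map :: "pauli \<Rightarrow> pauli \<Rightarrow> pauli \<Rightarrow> pauli" where
  "ctrl_map s t p = padd p (padd (sel (lam p s) t) (sel (lam p t) s))"

definition pauli_on :: "nat \<Rightarrow> mat2 \<Rightarrow> pauli" where
  "pauli_on i \<sigma> = (if \<sigma> = pZ then Zq i else if \<sigma> = pX then Xq i else padd (Zq i) (Xq i))"

definition local_paulis :: "nat \<Rightarrow> pauli set" where
  "local_paulis i = pauli_on i ` paulis3"

lemma paulis_distinct: "pX \<noteq> pZ" "pY \<noteq> pZ" "pY \<noteq> pX"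
  by (simp_all add: pX_mat pY_mat pZ_mat mat2_of_eq_iff)

lemma local_paulis_eq: "local_paulis i = {Zq i, Xq i, padd (Zq i) (Xq i)}"
  by (auto simp: local_paulis_def paulis3_def pauli_on_def paulis_distinct)

lemma ctrl_map_commute: "ctrl_map s t = ctrl_map t s"
  by (simp add: fun_eq_iff ctrl_map_def padd.commute)

lemma pauli_linear_ctrl_map: "pauli_linear (ctrl_map s t)"
  unfolding pauli_linear_def ctrl_map_def
  by (simp add: lam_padd_left sel_xor padd.assoc padd.commute padd.left_commute)

lemma comp_ctrl_map:
  assumes h: "pauli_linear h" and symp: "\<And>p q. lam (h p) (h q) = lam p q"
  shows "h \<circ> ctrl_map s t = ctrl_map (h s) (h t) \<circ> h"
proof
  fix p
  have lin: "h (padd x y) = padd (h x) (h y)" for x y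
    using h unfolding pauli_linear_def by blast
  have "h (sel b u) = sel b (h u)" for b u
    using pauli_linear_zero[OF h] by (simp add: sel_def)
  then show "(h \<circ> ctrl_map s t) p = (ctrl_map (h s) (h t) \<circ> h) p"
    by (simp add: ctrl_map_def lin symp)
qed

lemma unitary_ctrl: "\<sigma> \<in> paulis3 \<Longrightarrow> \<tau> \<in> paulis3 \<Longrightarrow> unitary (ctrl \<sigma> \<tau>)"
  unfolding paulis3_def unitary_def
  by (elim insertE emptyE; simp add: ctrl_def mat_literal_simps)

lemma ctrl_pauli_conj:
  assumes "\<sigma> \<in> paulis3" "\<tau> \<in> paulis3"
  shows "pauli_conj (ctrl \<sigma> \<tau>) (ctrl_map (pauli_on 0 \<sigma>) (pauli_on 1 \<tau>))"
proof (rule pauli_conj_basisI[OF unitary_ctrl[OF assms] pauli_linear_ctrl_map])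
  fix b
  assume "b \<in> {Zq 0, Xq 0, Zq 1, Xq 1}"
  \<comment> \<open>every phase that occurs is a power of \<open>\<i>\<close>\<close>
  with assms have "\<exists>c\<in>{1, -1, \<i>, -\<i>}. adj (ctrl \<sigma> \<tau>) ** pmat b ** ctrl \<sigma> \<tau>
                      = smul c (pmat (ctrl_map (pauli_on 0 \<sigma>) (pauli_on 1 \<tau>) b))"
    unfolding paulis3_def
    by (elim insertE emptyE; simp add: ctrl_def mat_literal_simps mat2_of_eq_iff pauli_on_def
        ctrl_map_def lam_eq_symp_form symp_form_def sel_def Zq_def Xq_def bit2_def padd_def pzero_def)
  then obtain c where "c \<in> {1, -1, \<i>, -\<i>}"
    and "adj (ctrl \<sigma> \<tau>) ** pmat b ** ctrl \<sigma> \<tau> = smul c (pmat (ctrl_map (pauli_on 0 \<sigma>) (pauli_on 1 \<tau>) b))"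
    by blast
  moreover from this(1) have "c \<noteq> 0"
    by auto
  ultimately show "\<exists>c. c \<noteq> 0 \<and> adj (ctrl \<sigma> \<tau>) ** pmat b ** ctrl \<sigma> \<tau>
                  = smul c (pmat (ctrl_map (pauli_on 0 \<sigma>) (pauli_on 1 \<tau>) b))"
    by blast
qed

lemma bact_ctrl:
  "\<sigma> \<in> paulis3 \<Longrightarrow> \<tau> \<in> paulis3 \<Longrightarrow> bact (ctrl \<sigma> \<tau>) B0 = frame_of (ctrl_map (pauli_on 0 \<sigma>) (pauli_on 1 \<tau>))"
  using bact_pauli_conj[OF ctrl_pauli_conj] by (simp add: frame_act_B0)

lemma ctrl_CX: "ctrl pZ pX = CX01"
  by (subst (2) mat4_of_entries) (simp add: ctrl_def mat_literal_simps CX01_def)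

lemmas ctrl_frame_simps = frame_key_def plane_mask_def pauli_code_def frame_of_def ctrl_map_def
  lam_eq_symp_form symp_form_def sel_def padd_def pzero_def Zq_def Xq_def bit2_def pauli_on_def
  paulis_distinct doubleton_eq_iff

lemma ctrl_frame_key_inj:
  "inj_on (\<lambda>(\<sigma>, \<tau>). frame_key (frame_of (ctrl_map (pauli_on 0 \<sigma>) (pauli_on 1 \<tau>)))) (paulis3 \<times> paulis3)"
  unfolding inj_on_def paulis3_def by (simp add: ctrl_frame_simps)

lemma ctrl_frame_key_neq_B0:
  "\<sigma> \<in> paulis3 \<Longrightarrow> \<tau> \<in> paulis3 \<Longrightarrow> frame_key (frame_of (ctrl_map (pauli_on 0 \<sigma>) (pauli_on 1 \<tau>))) \<noteq> frame_key B0"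
  unfolding paulis3_def by (elim insertE emptyE; simp add: ctrl_frame_simps B0_def)

definition respects_qubits :: "(pauli \<Rightarrow> pauli) \<Rightarrow> bool" where
  "respects_qubits h \<longleftrightarrow>
     h ` local_paulis 0 \<subseteq> local_paulis 0 \<and> h ` local_paulis 1 \<subseteq> local_paulis 1 \<or>
     h ` local_paulis 0 \<subseteq> local_paulis 1 \<and> h ` local_paulis 1 \<subseteq> local_paulis 0"

lemma respects_qubits_comp:
  assumes "respects_qubits h" "respects_qubits k"
  shows "respects_qubits (h \<circ> k)"
  using assms unfolding respects_qubits_def image_comp[symmetric]
  by (meson image_mono order_trans)

lemma local_maps_respect_qubits: "h \<in> local_maps \<Longrightarrow> respects_qubits h"
proof (induction rule: local_maps.induct)
  case local_maps_id
  show ?case by (simp add: respects_qubits_def)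
next
  case (local_maps_step s h)
  have "respects_qubits s"
    using local_maps_step.hyps(1) unfolding local_gens_def respects_qubits_def local_paulis_eq
    by (elim insertE emptyE; simp add: lift0_def lift1_def pswap_def shear_def Zq_def Xq_def bit2_def padd_def)
  with local_maps_step.IH show ?case
    by (rule respects_qubits_comp)
qed

lemma local_CX_local_class:
  assumes "L1 \<in> LocCliff" "L2 \<in> LocCliff"
  shows "\<exists>\<sigma>\<in>paulis3. \<exists>\<tau>\<in>paulis3. bact (L2 ** CX01 ** L1) B0 \<in> eef_class (bact (ctrl \<sigma> \<tau>) B0)"
proof -
  obtain h1 where h1: "h1 \<in> local_maps" "pauli_conj L1 h1" and U1: "unitary L1"
    using LocCliff_conj[OF assms(1)] by blast
  obtain h2 where h2: "h2 \<in> local_maps" "pauli_conj L2 h2"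
    using LocCliff_conj[OF assms(2)] by blast
  define s t where "s = pauli_on 0 pZ" and "t = pauli_on 1 pX"
  have "pauli_conj CX01 (ctrl_map s t)"
    using ctrl_pauli_conj[of pZ pX] by (simp add: s_def t_def ctrl_CX paulis3_def)
  then have "bact (L2 ** CX01 ** L1) B0 = frame_of (h1 \<circ> (ctrl_map s t \<circ> h2))"
    using bact_pauli_conj[OF pauli_conj_mult[OF pauli_conj_mult[OF h2(2)] h1(2)]] by (simp add: frame_act_B0)
  also have "h1 \<circ> (ctrl_map s t \<circ> h2) = ctrl_map (h1 s) (h1 t) \<circ> (h1 \<circ> h2)"
    by (simp only: comp_assoc[symmetric]
        comp_ctrl_map[OF pauli_conj_linear[OF U1 h1(2)] pauli_conj_lam[OF U1 h1(2)]])
  also have "frame_of \<dots> = frame_act (h1 \<circ> h2) (frame_of (ctrl_map (h1 s) (h1 t)))"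
    by (simp add: frame_act_frame_of pauli_linear_ctrl_map)
  finally have eq: "bact (L2 ** CX01 ** L1) B0 = frame_act (h1 \<circ> h2) (frame_of (ctrl_map (h1 s) (h1 t)))" .
  have "s \<in> local_paulis 0" "t \<in> local_paulis 1"
    by (simp_all add: s_def t_def local_paulis_def paulis3_def)
  then obtain a b where ab: "a \<in> local_paulis 0" "b \<in> local_paulis 1" "ctrl_map (h1 s) (h1 t) = ctrl_map a b"
    using local_maps_respect_qubits[OF h1(1)] ctrl_map_commute
    unfolding respects_qubits_def by blast
  then obtain \<sigma> \<tau> where st: "\<sigma> \<in> paulis3" "\<tau> \<in> paulis3" "a = pauli_on 0 \<sigma>" "b = pauli_on 1 \<tau>"
    unfolding local_paulis_def by blast
  have "bact (L2 ** CX01 ** L1) B0 = frame_act (h1 \<circ> h2) (bact (ctrl \<sigma> \<tau>) B0)"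
    unfolding eq ab(3) st(3,4) bact_ctrl[OF st(1,2)] ..
  then show ?thesis
    using st(1,2) local_maps_comp[OF h1(1) h2(1)] unfolding eef_class_eq by blast
qed

lemma inj_on_eef_class_ctrl:
  "inj_on (\<lambda>(\<sigma>, \<tau>). eef_class (bact (ctrl \<sigma> \<tau>) B0)) (paulis3 \<times> paulis3)"
proof (rule inj_onI, clarify)
  fix \<sigma> \<tau> \<sigma>' \<tau>'
  assume st: "\<sigma> \<in> paulis3" "\<tau> \<in> paulis3" "\<sigma>' \<in> paulis3" "\<tau>' \<in> paulis3"
    and "eef_class (bact (ctrl \<sigma> \<tau>) B0) = eef_class (bact (ctrl \<sigma>' \<tau>') B0)"
  then have "frame_key (frame_of (ctrl_map (pauli_on 0 \<sigma>) (pauli_on 1 \<tau>)))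
           = frame_key (frame_of (ctrl_map (pauli_on 0 \<sigma>') (pauli_on 1 \<tau>')))"
    by (metis eef_class_key bact_ctrl)
  with st show "\<sigma> = \<sigma>' \<and> \<tau> = \<tau>'"
    using inj_onD[OF ctrl_frame_key_inj, of "(\<sigma>, \<tau>)" "(\<sigma>', \<tau>')"] by simp
qed

lemma eef_class_ctrl_neq_B0:
  "\<sigma> \<in> paulis3 \<Longrightarrow> \<tau> \<in> paulis3 \<Longrightarrow> eef_class (bact (ctrl \<sigma> \<tau>) B0) \<noteq> eef_class B0"
  using ctrl_frame_key_neq_B0 eef_class_key bact_ctrl by metis

theorem mainTheorem5:
  shows "ctrl pZ pX = CX01
    \<and> inj_on (\<lambda>(\<sigma>, \<tau>). eef_class (bact (ctrl \<sigma> \<tau>) B0)) (paulis3 \<times> paulis3)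
    \<and> (\<forall>\<sigma>\<in>paulis3. \<forall>\<tau>\<in>paulis3. eef_class (bact (ctrl \<sigma> \<tau>) B0) \<noteq> eef_class B0)
    \<and> (\<forall>L1\<in>LocCliff. \<forall>L2\<in>LocCliff. \<exists>\<sigma>\<in>paulis3. \<exists>\<tau>\<in>paulis3.
          bact (L2 ** CX01 ** L1) B0 \<in> eef_class (bact (ctrl \<sigma> \<tau>) B0))"
  using ctrl_CX inj_on_eef_class_ctrl eef_class_ctrl_neq_B0 local_CX_local_class by blast

end
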